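(* Let $(\mathbf{X},\mathbf{T})$ and $(\mathbf{Y},\mathbf{R})$ be nonautonomous dynamical systems and let $\boldsymbol{\pi}=\{\pi_k\}_{k=0}^\infty$ be a semiconjugacy from $(\mathbf{X},\mathbf{T})$ to $(\mathbf{Y},\mathbf{R})$. Let $\mu\in M(X_0)$ and let $\nu=\pi_{0,*}\mu$ be the pushforward of $\mu$ under $\pi_0$, i.e. $\nu(A)=\mu(\pi_0^{-1}A)$ for all Borel subsets $A\subset Y_0$. (1) If $\boldsymbol{\pi}$ is an equisemiconjugacy, then $\underline{h}_\mu(\mathbf{T})\ge\underline{h}_\nu(\mathbf{R})$ and $\overline{h}_\mu(\mathbf{T})\ge\overline{h}_\nu(\mathbf{R})$. (2) If, furthermore, $\boldsymbol{\pi}$ is an equiconjugacy, then $\underline{h}_\mu(\mathbf{T})=\underline{h}_\nu(\mathbf{R})$ and $\overline{h}_\mu(\mathbf{T})=\overline{h}_\nu(\mathbf{R})$.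
   Context: A nonautonomous dynamical system (NDS) $(\mathbf{X},\mathbf{T})$ consists of a sequence $\mathbf{X}=\{X_k\}_{k=0}^\infty$ of compact metric spaces $(X_k,d_{X_k})$ and a sequence $\mathbf{T}=\{T_k\}_{k=0}^\infty$ of continuous maps $T_k:X_k\to X_{k+1}$. Put $\mathbf{T}^0=\mathrm{id}_{X_0}$ and $\mathbf{T}^j=T_{j-1}\circ\cdots\circ T_0:X_0\to X_j$. For $n\ge1$ and $x,y\in X_0$ let $d_n^{\mathbf{T}}(x,y)=\max_{0\le j\le n-1}d_{X_j}(\mathbf{T}^jx,\mathbf{T}^jy)$, and for $\varepsilon>0$ let $B_n^{\mathbf{T}}(x,\varepsilon)=\{y\in X_0:d_n^{\mathbf{T}}(x,y)<\varepsilon\}$. $M(X_0)$ is the set of Borel probability measures on $X_0$. The same definitions apply to $(\mathbf{Y},\mathbf{R})$ with metrics $d_{Y_k}$. Semiconjugacies: a semiconjugacy from $(\mathbf{X},\mathbf{T})$ to $(\mathbf{Y},\mathbf{R})$ is a sequence $\boldsymbol{\pi}=\{\pi_k\}_{k=0}^\infty$ of surjective continuous maps $\pi_k:X_k\to Y_k$ with $R_k\circ\pi_k=\pi_{k+1}\circ T_k$ for all $k\ge0$; it is a conjugacy if every $\pi_k$ is a homeomorphism. It is an equisemiconjugacy if it is equicontinuous: for every $\varepsilon>0$ there is $\delta>0$ such that for all $k\ge0$ and $x',x''\in X_k$, $d_{X_k}(x',x'')<\delta$ implies $d_{Y_k}(\pi_kx',\pi_kx'')<\varepsilon$. It is an equiconjugacy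 if it is a conjugacy and both $\boldsymbol{\pi}$ and $\boldsymbol{\pi}^{-1}=\{\pi_k^{-1}\}_{k=0}^\infty$ are equicontinuous. Measure-theoretic local entropies: $\underline{h}_\mu(\mathbf{T},x)=\lim_{\varepsilon\to0}\liminf_{n\to\infty}\frac{-\log\mu(B_n^{\mathbf{T}}(x,\varepsilon))}{n}$ and $\overline{h}_\mu(\mathbf{T},x)=\lim_{\varepsilon\to0}\limsup_{n\to\infty}\frac{-\log\mu(B_n^{\mathbf{T}}(x,\varepsilon))}{n}$, with $\log0=-\infty$. Measure-theoretic lower and upper entropies: $\underline{h}_\mu(\mathbf{T})=\int_{X_0}\underline{h}_\mu(\mathbf{T},x)\,d\mu(x)$ and $\overline{h}_\mu(\mathbf{T})=\int_{X_0}\overline{h}_\mu(\mathbf{T},x)\,d\mu(x)$. *)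

theory Defs
  imports "HOL-Analysis.Analysis" "HOL-Probability.Probability_Measure"
begin

text \<open>
  A sequence of metric spaces is a function from \<^typ>\<open>nat\<close> into the library type of (bundled)
  metric spaces with an explicit carrier set. The carriers may be different subsets of the common
  type, so the spaces of the sequence are unrelated to each other; values of maps and distances
  outside the carriers are never used.
\<close>

definition nds :: "(nat \<Rightarrow> 'a metric) \<Rightarrow> (nat \<Rightarrow> 'a \<Rightarrow> 'a) \<Rightarrow> bool" where
  "nds X T \<longleftrightarrow>
     (\<forall>k. compact_space (mtopology_of (X k))) \<and>
     (\<forall>k. continuous_map (mtopology_of (X k)) (mtopology_of (X (Suc k))) (T k))"

primrec nds_iter :: "(nat \<Rightarrow> 'a \<Rightarrow> 'a) \<Rightarrow> nat \<Rightarrow> 'a \<Rightarrow> 'a" where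
  "nds_iter T 0 = id"
| "nds_iter T (Suc j) = T j \<circ> nds_iter T j"

text \<open>
  Only \<open>n \<ge> 1\<close> is meaningful; because of truncated subtraction the value at \<open>n = 0\<close> is the one at
  \<open>n = 1\<close>, which has no influence on the limits below.
\<close>

definition bowen_dist ::
  "(nat \<Rightarrow> 'a metric) \<Rightarrow> (nat \<Rightarrow> 'a \<Rightarrow> 'a) \<Rightarrow> nat \<Rightarrow> 'a \<Rightarrow> 'a \<Rightarrow> real" where
  "bowen_dist X T n x y =
     Max ((\<lambda>j. mdist (X j) (nds_iter T j x) (nds_iter T j y)) ` {0..n - 1})"

definition bowen_ball ::
  "(nat \<Rightarrow> 'a metric) \<Rightarrow> (nat \<Rightarrow> 'a \<Rightarrow> 'a) \<Rightarrow> nat \<Rightarrow> 'a \<Rightarrow> real \<Rightarrow> 'a set" where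
  "bowen_ball X T n x \<epsilon> = {y \<in> mspace (X 0). bowen_dist X T n x y < \<epsilon>}"

definition borel_metric :: "'a metric \<Rightarrow> 'a measure" where
  "borel_metric m = sigma (mspace m) {U. openin (mtopology_of m) U}"

definition borel_probs :: "'a metric \<Rightarrow> 'a measure set" where
  "borel_probs m = {\<mu>. prob_space \<mu> \<and> sets \<mu> = sets (borel_metric m)}"

definition semiconjugacy ::
  "(nat \<Rightarrow> 'a metric) \<Rightarrow> (nat \<Rightarrow> 'a \<Rightarrow> 'a) \<Rightarrow> (nat \<Rightarrow> 'b metric) \<Rightarrow> (nat \<Rightarrow> 'b \<Rightarrow> 'b) \<Rightarrow>
   (nat \<Rightarrow> 'a \<Rightarrow> 'b) \<Rightarrow> bool" where
  "semiconjugacy X T Y R \<pi> \<longleftrightarrow>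
     (\<forall>k. continuous_map (mtopology_of (X k)) (mtopology_of (Y k)) (\<pi> k) \<and>
          \<pi> k ` mspace (X k) = mspace (Y k)) \<and>
     (\<forall>k. \<forall>x\<in>mspace (X k). R k (\<pi> k x) = \<pi> (Suc k) (T k x))"

definition conjugacy ::
  "(nat \<Rightarrow> 'a metric) \<Rightarrow> (nat \<Rightarrow> 'a \<Rightarrow> 'a) \<Rightarrow> (nat \<Rightarrow> 'b metric) \<Rightarrow> (nat \<Rightarrow> 'b \<Rightarrow> 'b) \<Rightarrow>
   (nat \<Rightarrow> 'a \<Rightarrow> 'b) \<Rightarrow> bool" where
  "conjugacy X T Y R \<pi> \<longleftrightarrow>
     semiconjugacy X T Y R \<pi> \<and>
     (\<forall>k. homeomorphic_map (mtopology_of (X k)) (mtopology_of (Y k)) (\<pi> k))"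

text \<open>Equicontinuity is uniform both in the index and in the points.\<close>

definition equicontinuous_seq ::
  "(nat \<Rightarrow> 'a metric) \<Rightarrow> (nat \<Rightarrow> 'b metric) \<Rightarrow> (nat \<Rightarrow> 'a \<Rightarrow> 'b) \<Rightarrow> bool" where
  "equicontinuous_seq X Y f \<longleftrightarrow>
     (\<forall>\<epsilon>>0. \<exists>\<delta>>0. \<forall>k. \<forall>x'\<in>mspace (X k). \<forall>x''\<in>mspace (X k).
        mdist (X k) x' x'' < \<delta> \<longrightarrow> mdist (Y k) (f k x') (f k x'') < \<epsilon>)"

definition equisemiconjugacy ::
  "(nat \<Rightarrow> 'a metric) \<Rightarrow> (nat \<Rightarrow> 'a \<Rightarrow> 'a) \<Rightarrow> (nat \<Rightarrow> 'b metric) \<Rightarrow> (nat \<Rightarrow> 'b \<Rightarrow> 'b) \<Rightarrow>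
   (nat \<Rightarrow> 'a \<Rightarrow> 'b) \<Rightarrow> bool" where
  "equisemiconjugacy X T Y R \<pi> \<longleftrightarrow> semiconjugacy X T Y R \<pi> \<and> equicontinuous_seq X Y \<pi>"

definition equiconjugacy ::
  "(nat \<Rightarrow> 'a metric) \<Rightarrow> (nat \<Rightarrow> 'a \<Rightarrow> 'a) \<Rightarrow> (nat \<Rightarrow> 'b metric) \<Rightarrow> (nat \<Rightarrow> 'b \<Rightarrow> 'b) \<Rightarrow>
   (nat \<Rightarrow> 'a \<Rightarrow> 'b) \<Rightarrow> bool" where
  "equiconjugacy X T Y R \<pi> \<longleftrightarrow>
     conjugacy X T Y R \<pi> \<and> equicontinuous_seq X Y \<pi> \<and>
     equicontinuous_seq Y X (\<lambda>k. inv_into (mspace (X k)) (\<pi> k))"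

text \<open>Logarithm with the convention \<open>log 0 = -\<infinity>\<close>, whereas \<open>ln 0 = 0\<close> in the library.\<close>

definition log_ext :: "real \<Rightarrow> ereal" where
  "log_ext p = (if p = 0 then -\<infinity> else ereal (ln p))"

text \<open>
  The inner lower and upper limits are nonincreasing in \<open>\<epsilon>\<close>, so the limits as \<open>\<epsilon>\<close> tends to 0 from
  the right exist in the extended reals.
\<close>

definition lower_local_entropy ::
  "(nat \<Rightarrow> 'a metric) \<Rightarrow> (nat \<Rightarrow> 'a \<Rightarrow> 'a) \<Rightarrow> 'a measure \<Rightarrow> 'a \<Rightarrow> ereal" where
  "lower_local_entropy X T \<mu> x =
     Lim (at_right 0) (\<lambda>\<epsilon>::real.
       liminf (\<lambda>n. - log_ext (measure \<mu> (bowen_ball X T n x \<epsilon>)) / ereal (real n)))"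

definition upper_local_entropy ::
  "(nat \<Rightarrow> 'a metric) \<Rightarrow> (nat \<Rightarrow> 'a \<Rightarrow> 'a) \<Rightarrow> 'a measure \<Rightarrow> 'a \<Rightarrow> ereal" where
  "upper_local_entropy X T \<mu> x =
     Lim (at_right 0) (\<lambda>\<epsilon>::real.
       limsup (\<lambda>n. - log_ext (measure \<mu> (bowen_ball X T n x \<epsilon>)) / ereal (real n)))"

text \<open>
  For a probability measure the local entropies are nonnegative (possibly \<open>\<infinity>\<close>), so the conversion
  to \<^typ>\<open>ennreal\<close> loses nothing and the integral is the one of a nonnegative extended real
  function.
\<close>

definition lower_entropy ::
  "(nat \<Rightarrow> 'a metric) \<Rightarrow> (nat \<Rightarrow> 'a \<Rightarrow> 'a) \<Rightarrow> 'a measure \<Rightarrow> ennreal" where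
  "lower_entropy X T \<mu> = (\<integral>\<^sup>+ x. e2ennreal (lower_local_entropy X T \<mu> x) \<partial>\<mu>)"

definition upper_entropy ::
  "(nat \<Rightarrow> 'a metric) \<Rightarrow> (nat \<Rightarrow> 'a \<Rightarrow> 'a) \<Rightarrow> 'a measure \<Rightarrow> ennreal" where
  "upper_entropy X T \<mu> = (\<integral>\<^sup>+ x. e2ennreal (upper_local_entropy X T \<mu> x) \<partial>\<mu>)"

end

theory Submission
  imports Defs
begin

text \<open>
  By equicontinuity with modulus \<open>\<delta>\<close> for \<open>\<epsilon>\<close>, the map \<open>\<pi> 0\<close> sends the Bowen ball of radius
  \<open>\<delta>\<close> at \<open>x\<close> into the Bowen ball of radius \<open>\<epsilon>\<close> at \<open>\<pi> 0 x\<close>, for every \<open>n\<close> at once. Hence the local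
  entropies of \<open>\<mu>\<close> at \<open>x\<close> dominate those of \<open>\<nu>\<close> at \<open>\<pi> 0 x\<close>, and integration gives (1). Integrating
  over a pushforward can only lower the integral of a function that is not known to be measurable,
  so measurability of the local entropies is never needed. Part (2) is (1) applied to \<open>\<pi>\<close> and to
  its inverse.
\<close>

section \<open>Integrals over pushforwards and monotone limits in the extended reals\<close>

lemma nn_integral_distr_le:
  assumes "g \<in> measurable M N"
  shows "(\<integral>\<^sup>+ y. f y \<partial>distr M N g) \<le> (\<integral>\<^sup>+ x. f (g x) \<partial>M)"
  unfolding nn_integral_def[of "distr M N g" f]
proof (rule SUP_least)
  \<comment> \<open>The integral of \<open>f\<close> is a supremum over simple functions below
    \<open>f\<close>. These are measurable even if \<open>f\<close> is not, so the change of
    variables is exact for each of them.\<close>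
  fix s assume "s \<in> {s. simple_function (distr M N g) s \<and> s \<le> f}"
  then have s: "simple_function (distr M N g) s" "\<And>y. s y \<le> f y"
    by (auto simp: le_fun_def)
  have "integral\<^sup>S (distr M N g) s = (\<integral>\<^sup>+ y. s y \<partial>distr M N g)"
    using s(1) by (rule nn_integral_eq_simple_integral[symmetric])
  also have "\<dots> = (\<integral>\<^sup>+ x. s (g x) \<partial>M)"
    using borel_measurable_simple_function[OF s(1)] by (intro nn_integral_distr assms) simp
  also have "\<dots> \<le> (\<integral>\<^sup>+ x. f (g x) \<partial>M)"
    by (intro nn_integral_mono s(2))
  finally show "integral\<^sup>S (distr M N g) s \<le> (\<integral>\<^sup>+ x. f (g x) \<partial>M)" .
qed

text \<open>A level below the supremum is exceeded at some \<open>t > a\<close>, and by monotonicity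
  on all of \<open>(a, t)\<close>. The supremum is thus a genuine limit, and \<open>Lim\<close>,
  which is defined by choice, must return it.\<close>

lemma Lim_at_right_antimono_ereal:
  fixes f :: "real \<Rightarrow> ereal"
  assumes "\<And>s t. a < s \<Longrightarrow> s \<le> t \<Longrightarrow> f t \<le> f s"
  shows "Lim (at_right a) f = (SUP t\<in>{a<..}. f t)"
proof (rule tendsto_Lim)
  show "(f \<longlongrightarrow> (SUP t\<in>{a<..}. f t)) (at_right a)"
  proof (rule increasing_tendsto)
    show "\<forall>\<^sub>F t in at_right a. f t \<le> (SUP t\<in>{a<..}. f t)"
      by (auto simp: eventually_at_filter intro!: always_eventually SUP_upper)
  next
    fix c assume "c < (SUP t\<in>{a<..}. f t)"
    then obtain t where t: "a < t" "c < f t"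
      by (auto simp: less_SUP_iff)
    then have "c < f s" if "a < s" "s < t" for s
      using assms[of s t] that by auto
    with t(1) show "\<forall>\<^sub>F s in at_right a. c < f s"
      by (auto simp: eventually_at_right_field)
  qed
qed simp

lemma neg_log_ext_divide_antimono:
  assumes "0 \<le> p" "p \<le> q" "0 < n"
  shows "- log_ext q / ereal (real n) \<le> - log_ext p / ereal (real n)"
proof (rule ereal_divide_right_mono)
  show "- log_ext q \<le> - log_ext p"
    \<comment> \<open>If \<open>p = 0\<close>, the right-hand side is \<infinity>; otherwise
      \<open>q\<close> is positive as well and \<open>ln\<close> is monotone.\<close>
    using assms by (auto simp: log_ext_def)
qed (use assms in simp)

section \<open>Borel sets of a metric space\<close>

lemma space_borel_metric [simp]: "space (borel_metric m) = mspace m"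
  unfolding borel_metric_def
  by (rule space_measure_of) (use openin_subset in fastforce)

lemma sets_borel_metric:
  "sets (borel_metric m) = sigma_sets (mspace m) {U. openin (mtopology_of m) U}"
  unfolding borel_metric_def
  by (rule sets_measure_of) (use openin_subset in fastforce)

lemma openin_sets_borel_metric:
  "openin (mtopology_of m) U \<Longrightarrow> U \<in> sets (borel_metric m)"
  by (simp add: sets_borel_metric)

lemma continuous_map_measurable:
  assumes "continuous_map (mtopology_of m1) (mtopology_of m2) f"
  shows "f \<in> measurable (borel_metric m1) (borel_metric m2)"
proof (rule measurable_sigma_sets[OF sets_borel_metric])
  show "{U. openin (mtopology_of m2) U} \<subseteq> Pow (mspace m2)"
    using openin_subset by fastforce
  show "f \<in> space (borel_metric m1) \<rightarrow> mspace m2"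
    using continuous_map_funspace[OF assms] by simp
  show "f -` U \<inter> space (borel_metric m1) \<in> sets (borel_metric m1)"
    if "U \<in> {U. openin (mtopology_of m2) U}" for U
  proof -
    have "f -` U \<inter> mspace m1 = {x \<in> topspace (mtopology_of m1). f x \<in> U}"
      by auto
    with that show ?thesis
      using openin_continuous_map_preimage[OF assms, of U] openin_sets_borel_metric by simp
  qed
qed

lemma borel_probs_space_sets:
  assumes "\<mu> \<in> borel_probs m"
  shows "prob_space \<mu>" "sets \<mu> = sets (borel_metric m)" "space \<mu> = mspace m"
  using assms sets_eq_imp_space_eq[of \<mu> "borel_metric m"] by (auto simp: borel_probs_def)

section \<open>Iterates and Bowen balls\<close>

lemma nds_iter_continuous:
  assumes "nds X T"
  shows "continuous_map (mtopology_of (X 0)) (mtopology_of (X j)) (nds_iter T j)"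
proof (induction j)
  case (Suc j)
  then show ?case
    using assms continuous_map_compose unfolding nds_def nds_iter.simps by blast
qed simp

lemma nds_iter_in_mspace:
  "nds X T \<Longrightarrow> x \<in> mspace (X 0) \<Longrightarrow> nds_iter T j x \<in> mspace (X j)"
  using continuous_map_funspace[OF nds_iter_continuous] by (fastforce simp: Pi_iff)

text \<open>The index set \<open>{0..n - 1}\<close> is finite and, by truncated subtraction,
  nonempty even for \<open>n = 0\<close>, so a bound on the maximum is a bound on every
  term.\<close>

lemma mem_bowen_ball_iff:
  "y \<in> bowen_ball X T n x \<epsilon> \<longleftrightarrow> y \<in> mspace (X 0) \<and>
     (\<forall>j\<le>n - 1. mdist (X j) (nds_iter T j x) (nds_iter T j y) < \<epsilon>)"
  by (auto simp: bowen_ball_def bowen_dist_def)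

lemma bowen_ball_mono: "\<epsilon> \<le> \<epsilon>' \<Longrightarrow> bowen_ball X T n x \<epsilon> \<subseteq> bowen_ball X T n x \<epsilon>'"
  by (fastforce simp: mem_bowen_ball_iff)

text \<open>Finitely many preimages of open balls under continuous iterates are intersected. The
  purpose is measurability of Bowen balls.\<close>

lemma openin_bowen_ball:
  assumes "nds X T" "x \<in> mspace (X 0)"
  shows "openin (mtopology_of (X 0)) (bowen_ball X T n x \<epsilon>)"
proof -
  have *: "openin (mtopology_of (X 0))
      {y \<in> topspace (mtopology_of (X 0)). nds_iter T j y \<in> mball_of (X j) (nds_iter T j x) \<epsilon>}" for j
    by (rule openin_continuous_map_preimage[OF nds_iter_continuous[OF assms(1)]])
       (simp add: mtopology_of_def mball_of_def Metric_space.openin_mball)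
  have "bowen_ball X T n x \<epsilon> = (\<Inter>j\<in>{..n - 1}.
      {y \<in> topspace (mtopology_of (X 0)). nds_iter T j y \<in> mball_of (X j) (nds_iter T j x) \<epsilon>})"
    \<comment> \<open>Membership in \<open>mball_of\<close> includes that both the centre and the
      point lie in the carrier.\<close>
    using nds_iter_in_mspace[OF assms(1)] assms(2)
    by (auto simp: mem_bowen_ball_iff)
  also have "openin (mtopology_of (X 0)) \<dots>"
    by (intro openin_INT2 *) auto
  finally show ?thesis .
qed

lemma bowen_ball_measurable:
  assumes "nds X T" "\<mu> \<in> borel_probs (X 0)" "x \<in> mspace (X 0)"
  shows "bowen_ball X T n x \<epsilon> \<in> sets \<mu>"
  using openin_sets_borel_metric[OF openin_bowen_ball] borel_probs_space_sets(2) assms by metis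

section \<open>Local entropies as suprema over the radius\<close>

abbreviation entropy_rate where
  "entropy_rate X T \<mu> x \<epsilon> n \<equiv> - log_ext (measure \<mu> (bowen_ball X T n x \<epsilon>)) / ereal (real n)"

text \<open>A larger radius gives a ball of larger measure, hence a smaller rate. The comparison is
  made for \<open>n > 0\<close>, which is enough for lower and upper limits.\<close>

lemma eventually_entropy_rate_antimono:
  assumes "nds X T" "\<mu> \<in> borel_probs (X 0)" "x \<in> mspace (X 0)" "s \<le> t"
  shows "\<forall>\<^sub>F n in sequentially. entropy_rate X T \<mu> x t n \<le> entropy_rate X T \<mu> x s n"
proof -
  interpret prob_space \<mu> by (rule borel_probs_space_sets[OF assms(2)])
  have "measure \<mu> (bowen_ball X T n x s) \<le> measure \<mu> (bowen_ball X T n x t)" for n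
    by (intro finite_measure_mono bowen_ball_mono bowen_ball_measurable assms)
  then show ?thesis
    by (intro eventually_mono[OF eventually_gt_at_top[of 0]] neg_log_ext_divide_antimono) auto
qed

text \<open>The lower limits grow as the radius shrinks, so their limit at 0 is a supremum. In this
  form local entropies of two systems can be compared radius by radius.\<close>

lemma lower_local_entropy_SUP:
  assumes "nds X T" "\<mu> \<in> borel_probs (X 0)" "x \<in> mspace (X 0)"
  shows "lower_local_entropy X T \<mu> x = (SUP \<epsilon>\<in>{0<..}. liminf (entropy_rate X T \<mu> x \<epsilon>))"
  unfolding lower_local_entropy_def
  by (intro Lim_at_right_antimono_ereal Liminf_mono eventually_entropy_rate_antimono assms)

lemma upper_local_entropy_SUP:
  assumes "nds X T" "\<mu> \<in> borel_probs (X 0)" "x \<in> mspace (X 0)"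
  shows "upper_local_entropy X T \<mu> x = (SUP \<epsilon>\<in>{0<..}. limsup (entropy_rate X T \<mu> x \<epsilon>))"
  unfolding upper_local_entropy_def
  by (intro Lim_at_right_antimono_ereal Limsup_mono eventually_entropy_rate_antimono assms)

section \<open>Semiconjugacies and pushforward measures\<close>

lemma semiconjugacy_nds_iter:
  assumes "nds X T" "semiconjugacy X T Y R \<pi>" "x \<in> mspace (X 0)"
  shows "nds_iter R j (\<pi> 0 x) = \<pi> j (nds_iter T j x)"
proof (induction j)
  case (Suc j)
  \<comment> \<open>The intertwining relation is given on carriers only; it is applied at
    \<open>nds_iter T j x\<close>, which lies in the carrier of \<open>X j\<close>.\<close>
  then show ?case
    using assms nds_iter_in_mspace[OF assms(1,3)] by (simp add: semiconjugacy_def)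
qed simp

lemma semiconjugacy_measurable:
  assumes "semiconjugacy X T Y R \<pi>" "\<mu> \<in> borel_probs (X 0)"
  shows "\<pi> 0 \<in> measurable \<mu> (borel_metric (Y 0))"
  using continuous_map_measurable[of "X 0" "Y 0" "\<pi> 0"] assms
    measurable_cong_sets[OF borel_probs_space_sets(2)[OF assms(2)] refl]
  by (auto simp: semiconjugacy_def)

lemma semiconjugacy_distr_borel_probs:
  assumes "semiconjugacy X T Y R \<pi>" "\<mu> \<in> borel_probs (X 0)"
  shows "distr \<mu> (borel_metric (Y 0)) (\<pi> 0) \<in> borel_probs (Y 0)"
  using prob_space.prob_space_distr[OF borel_probs_space_sets(1)[OF assms(2)]
      semiconjugacy_measurable[OF assms]]
  by (simp add: borel_probs_def)

section \<open>Entropy inequalities for equisemiconjugacies\<close>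

lemma equisemiconjugacy_entropy_rate_le:
  assumes "nds X T" "nds Y R" "equisemiconjugacy X T Y R \<pi>" "\<mu> \<in> borel_probs (X 0)"
    and "x \<in> mspace (X 0)" "\<epsilon> > 0"
  obtains \<delta> where "\<delta> > 0"
    "\<forall>\<^sub>F n in sequentially. entropy_rate Y R (distr \<mu> (borel_metric (Y 0)) (\<pi> 0)) (\<pi> 0 x) \<epsilon> n
       \<le> entropy_rate X T \<mu> x \<delta> n"
proof -
  let ?\<nu> = "distr \<mu> (borel_metric (Y 0)) (\<pi> 0)"
  interpret prob_space \<mu> by (rule borel_probs_space_sets[OF assms(4)])
  have sc: "semiconjugacy X T Y R \<pi>" and ec: "equicontinuous_seq X Y \<pi>"
    using assms(3) by (auto simp: equisemiconjugacy_def)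
  have \<pi>0: "\<pi> 0 ` mspace (X 0) = mspace (Y 0)"
    using sc by (auto simp: semiconjugacy_def)
  have meas: "\<pi> 0 \<in> measurable \<mu> (borel_metric (Y 0))"
    using semiconjugacy_measurable[OF sc assms(4)] .
  \<comment> \<open>The modulus is uniform in the index \<open>k\<close>, so a single \<delta>
    serves the Bowen balls of all lengths \<open>n\<close>.\<close>
  obtain \<delta> where \<delta>: "\<delta> > 0"
    "\<And>k x' x''. x' \<in> mspace (X k) \<Longrightarrow> x'' \<in> mspace (X k) \<Longrightarrow> mdist (X k) x' x'' < \<delta>
       \<Longrightarrow> mdist (Y k) (\<pi> k x') (\<pi> k x'') < \<epsilon>"
    using ec assms(6) unfolding equicontinuous_seq_def by meson
  have "measure \<mu> (bowen_ball X T n x \<delta>) \<le> measure ?\<nu> (bowen_ball Y R n (\<pi> 0 x) \<epsilon>)" for n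
  proof -
    have ball: "bowen_ball Y R n (\<pi> 0 x) \<epsilon> \<in> sets (borel_metric (Y 0))"
      using bowen_ball_measurable[OF assms(2) semiconjugacy_distr_borel_probs[OF sc assms(4)]]
        imageI[OF assms(5), of "\<pi> 0"] \<pi>0 by simp
    \<comment> \<open>By the intertwining of iterates, the \<open>j\<close>-th distance in
      \<open>Y\<close> is that between the images under \<open>\<pi> j\<close> of the
      \<open>j\<close>-th iterates in \<open>X\<close>.\<close>
    have "bowen_ball X T n x \<delta> \<subseteq> \<pi> 0 -` bowen_ball Y R n (\<pi> 0 x) \<epsilon> \<inter> space \<mu>"
      using \<delta>(2) \<pi>0 assms(5) nds_iter_in_mspace[OF assms(1)] borel_probs_space_sets(3)[OF assms(4)]
      by (auto simp: mem_bowen_ball_iff semiconjugacy_nds_iter[OF assms(1) sc])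
    then show ?thesis
      unfolding measure_distr[OF meas ball]
      by (intro finite_measure_mono measurable_sets[OF meas ball])
  qed
  then have "\<forall>\<^sub>F n in sequentially. entropy_rate Y R ?\<nu> (\<pi> 0 x) \<epsilon> n \<le> entropy_rate X T \<mu> x \<delta> n"
    by (intro eventually_mono[OF eventually_gt_at_top[of 0]] neg_log_ext_divide_antimono) auto
  with \<delta>(1) show thesis by (rule that)
qed

lemma equisemiconjugacy_local_entropy_le:
  assumes "nds X T" "nds Y R" "equisemiconjugacy X T Y R \<pi>" "\<mu> \<in> borel_probs (X 0)"
    and "x \<in> mspace (X 0)"
  defines "\<nu> \<equiv> distr \<mu> (borel_metric (Y 0)) (\<pi> 0)"
  shows "lower_local_entropy Y R \<nu> (\<pi> 0 x) \<le> lower_local_entropy X T \<mu> x"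
    and "upper_local_entropy Y R \<nu> (\<pi> 0 x) \<le> upper_local_entropy X T \<mu> x"
proof -
  have sc: "semiconjugacy X T Y R \<pi>"
    using assms(3) by (simp add: equisemiconjugacy_def)
  have \<nu>: "\<nu> \<in> borel_probs (Y 0)"
    unfolding \<nu>_def by (rule semiconjugacy_distr_borel_probs[OF sc assms(4)])
  have y: "\<pi> 0 x \<in> mspace (Y 0)"
    using sc assms(5) by (auto simp: semiconjugacy_def)
  \<comment> \<open>Both local entropies are suprema over radii, so it suffices to dominate each
    term for \<epsilon> by the term for some \<delta>; how \<delta> varies with \<epsilon> is
    irrelevant.\<close>
  have rate: "\<exists>\<delta>\<in>{0<..}. \<forall>\<^sub>F n in sequentially.
      entropy_rate Y R \<nu> (\<pi> 0 x) \<epsilon> n \<le> entropy_rate X T \<mu> x \<delta> n" if "\<epsilon> \<in> {0<..}" for \<epsilon>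
    using equisemiconjugacy_entropy_rate_le[OF assms(1-5), of \<epsilon>] that unfolding \<nu>_def by auto
  show "lower_local_entropy Y R \<nu> (\<pi> 0 x) \<le> lower_local_entropy X T \<mu> x"
    unfolding lower_local_entropy_SUP[OF assms(2) \<nu> y] lower_local_entropy_SUP[OF assms(1,4,5)]
    by (rule SUP_mono, drule rate, erule bexE, rule bexI, erule Liminf_mono)
  show "upper_local_entropy Y R \<nu> (\<pi> 0 x) \<le> upper_local_entropy X T \<mu> x"
    unfolding upper_local_entropy_SUP[OF assms(2) \<nu> y] upper_local_entropy_SUP[OF assms(1,4,5)]
    by (rule SUP_mono, drule rate, erule bexE, rule bexI, erule Limsup_mono)
qed

lemma equisemiconjugacy_entropy_le:
  assumes "nds X T" "nds Y R" "equisemiconjugacy X T Y R \<pi>" "\<mu> \<in> borel_probs (X 0)"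
  defines "\<nu> \<equiv> distr \<mu> (borel_metric (Y 0)) (\<pi> 0)"
  shows "lower_entropy Y R \<nu> \<le> lower_entropy X T \<mu>"
    and "upper_entropy Y R \<nu> \<le> upper_entropy X T \<mu>"
proof -
  have meas: "\<pi> 0 \<in> measurable \<mu> (borel_metric (Y 0))"
    using semiconjugacy_measurable[of X T Y R \<pi> \<mu>] assms(3,4)
    by (simp add: equisemiconjugacy_def)
  note local_le = equisemiconjugacy_local_entropy_le[OF assms(1-4), folded \<nu>_def]
  show "lower_entropy Y R \<nu> \<le> lower_entropy X T \<mu>"
    unfolding lower_entropy_def \<nu>_def
    \<comment> \<open>The integral over \<nu> is first bounded by the integral over \<mu> of the
      pulled-back function; the integrands are then compared pointwise on the carrier of
      \<open>X 0\<close>.\<close>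
    by (rule order_trans[OF nn_integral_distr_le[OF meas]], fold \<nu>_def)
       (intro nn_integral_mono e2ennreal_mono local_le, simp add: borel_probs_space_sets[OF assms(4)])
  show "upper_entropy Y R \<nu> \<le> upper_entropy X T \<mu>"
    unfolding upper_entropy_def \<nu>_def
    by (rule order_trans[OF nn_integral_distr_le[OF meas]], fold \<nu>_def)
       (intro nn_integral_mono e2ennreal_mono local_le, simp add: borel_probs_space_sets[OF assms(4)])
qed

section \<open>The inverse of a conjugacy\<close>

lemma conjugacy_inv_into:
  assumes "conjugacy X T Y R \<pi>" "x \<in> mspace (X k)"
  shows "inv_into (mspace (X k)) (\<pi> k) (\<pi> k x) = x"
proof -
  have "inj_on (\<pi> k) (mspace (X k))"
    using assms(1) homeomorphic_imp_injective_map[of "mtopology_of (X k)"]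
    by (auto simp: conjugacy_def)
  with assms(2) show ?thesis by simp
qed

lemma conjugacy_inverse_semiconjugacy:
  assumes "nds X T" "conjugacy X T Y R \<pi>"
  shows "semiconjugacy Y R X T (\<lambda>k. inv_into (mspace (X k)) (\<pi> k))"
    (is "semiconjugacy _ _ _ _ ?\<rho>")
proof -
  have img: "\<pi> k ` mspace (X k) = mspace (Y k)"
    and comm: "x \<in> mspace (X k) \<Longrightarrow> R k (\<pi> k x) = \<pi> (Suc k) (T k x)" for k x
    using assms(2) by (auto simp: conjugacy_def semiconjugacy_def)
  have hm: "homeomorphic_map (mtopology_of (X k)) (mtopology_of (Y k)) (\<pi> k)" for k
    using assms(2) by (auto simp: conjugacy_def)
  note inv = conjugacy_inv_into[OF assms(2)]
  have cont: "continuous_map (mtopology_of (Y k)) (mtopology_of (X k)) (?\<rho> k)" for k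
  proof -
    obtain g where g: "homeomorphic_maps (mtopology_of (X k)) (mtopology_of (Y k)) (\<pi> k) g"
      using hm[of k] unfolding homeomorphic_map_maps by blast
    then have "continuous_map (mtopology_of (Y k)) (mtopology_of (X k)) g"
      by (simp add: homeomorphic_maps_def)
    \<comment> \<open>The continuous inverse \<open>g\<close> need not equal
      \<open>?\<rho> k\<close> off the carrier of \<open>Y k\<close>; agreement on the carrier
      transfers continuity.\<close>
    moreover have "g y = ?\<rho> k y" if "y \<in> topspace (mtopology_of (Y k))" for y
      using that g inv unfolding homeomorphic_maps_def topspace_mtopology_of img[symmetric] by auto
    ultimately show ?thesis by (rule continuous_map_eq)
  qed
  have "T k x \<in> mspace (X (Suc k))" if "x \<in> mspace (X k)" for k x
    using that assms(1) continuous_map_funspace[of "mtopology_of (X k)" "mtopology_of (X (Suc k))"]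
    by (fastforce simp: nds_def)
  \<comment> \<open>Writing \<open>y\<close> as \<open>\<pi> k x\<close> turns both sides into
    \<open>T k x\<close>. On the right, the inverse cancels \<open>\<pi> (Suc k)\<close> because
    \<open>T k x\<close> lies in the carrier of \<open>X (Suc k)\<close>.\<close>
  then have "T k (?\<rho> k y) = ?\<rho> (Suc k) (R k y)" if "y \<in> mspace (Y k)" for k y
    using that unfolding img[symmetric] by (auto simp: inv comm)
  moreover have "?\<rho> k ` mspace (Y k) = mspace (X k)" for k
    unfolding img[symmetric] image_image using inv by auto
  ultimately show ?thesis
    using cont by (simp add: semiconjugacy_def)
qed

text \<open>The composite of \<open>\<pi> 0\<close> with its inverse is the identity on the carrier,
  so pushing forward twice restores \<mu>. This identifies the target measure when the inequalities
  are applied to the inverse.\<close>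

lemma conjugacy_distr_inverse:
  assumes "nds X T" "conjugacy X T Y R \<pi>" "\<mu> \<in> borel_probs (X 0)"
  shows "distr (distr \<mu> (borel_metric (Y 0)) (\<pi> 0)) (borel_metric (X 0))
           (inv_into (mspace (X 0)) (\<pi> 0)) = \<mu>"
proof -
  let ?\<rho> = "inv_into (mspace (X 0)) (\<pi> 0)"
  have sc: "semiconjugacy X T Y R \<pi>"
    using assms(2) by (simp add: conjugacy_def)
  have "?\<rho> \<in> measurable (borel_metric (Y 0)) (borel_metric (X 0))"
    using conjugacy_inverse_semiconjugacy[OF assms(1,2)]
    by (intro continuous_map_measurable) (simp add: semiconjugacy_def)
  then have "distr (distr \<mu> (borel_metric (Y 0)) (\<pi> 0)) (borel_metric (X 0)) ?\<rho> =
      distr \<mu> (borel_metric (X 0)) (?\<rho> \<circ> \<pi> 0)"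
    by (rule distr_distr) (rule semiconjugacy_measurable[OF sc assms(3)])
  \<comment> \<open>As a target, \<open>distr\<close> uses only the space and the measurable sets,
    so \<open>borel_metric (X 0)\<close> may be replaced by \<mu> itself.\<close>
  also have "\<dots> = distr \<mu> \<mu> (\<lambda>x. x)"
    by (intro distr_cong)
       (simp_all add: borel_probs_space_sets[OF assms(3)] conjugacy_inv_into[OF assms(2)])
  also have "\<dots> = \<mu>" by simp
  finally show ?thesis .
qed

theorem theorem4p4:
  fixes X :: "nat \<Rightarrow> 'a metric" and T :: "nat \<Rightarrow> 'a \<Rightarrow> 'a"
    and Y :: "nat \<Rightarrow> 'b metric" and R :: "nat \<Rightarrow> 'b \<Rightarrow> 'b"
    and \<pi> :: "nat \<Rightarrow> 'a \<Rightarrow> 'b"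
    and \<mu> :: "'a measure" and \<nu> :: "'b measure"
  assumes "nds X T" and "nds Y R"
    and "semiconjugacy X T Y R \<pi>"
    and "\<mu> \<in> borel_probs (X 0)"
    and "\<nu> = distr \<mu> (borel_metric (Y 0)) (\<pi> 0)"
  shows "(equisemiconjugacy X T Y R \<pi> \<longrightarrow>
            lower_entropy X T \<mu> \<ge> lower_entropy Y R \<nu> \<and>
            upper_entropy X T \<mu> \<ge> upper_entropy Y R \<nu>) \<and>
         (equiconjugacy X T Y R \<pi> \<longrightarrow>
            lower_entropy X T \<mu> = lower_entropy Y R \<nu> \<and>
            upper_entropy X T \<mu> = upper_entropy Y R \<nu>)"
proof -
  let ?\<rho> = "\<lambda>k. inv_into (mspace (X k)) (\<pi> k)"
  have le: "lower_entropy Y R \<nu> \<le> lower_entropy X T \<mu> \<and> upper_entropy Y R \<nu> \<le> upper_entropy X T \<mu>"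
    if "equisemiconjugacy X T Y R \<pi>"
    using equisemiconjugacy_entropy_le[OF assms(1,2) that assms(4)] assms(5) by simp
  have ge: "lower_entropy X T \<mu> \<le> lower_entropy Y R \<nu> \<and> upper_entropy X T \<mu> \<le> upper_entropy Y R \<nu>"
    if "equiconjugacy X T Y R \<pi>"
  proof -
    have c: "conjugacy X T Y R \<pi>" and ec: "equicontinuous_seq Y X ?\<rho>"
      using that by (auto simp: equiconjugacy_def)
    have "equisemiconjugacy Y R X T ?\<rho>"
      using conjugacy_inverse_semiconjugacy[OF assms(1) c] ec by (simp add: equisemiconjugacy_def)
    moreover have "\<nu> \<in> borel_probs (Y 0)"
      unfolding assms(5) by (rule semiconjugacy_distr_borel_probs[OF assms(3,4)])
    moreover have "distr \<nu> (borel_metric (X 0)) (?\<rho> 0) = \<mu>"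
      unfolding assms(5) by (rule conjugacy_distr_inverse[OF assms(1) c assms(4)])
    \<comment> \<open>The inequalities are applied with the two systems exchanged, starting from
      \<nu>, whose pushforward under the inverse is \<mu>.\<close>
    ultimately show ?thesis
      using equisemiconjugacy_entropy_le[OF assms(2,1), of ?\<rho> \<nu>] by simp
  qed
  have "equisemiconjugacy X T Y R \<pi>" if "equiconjugacy X T Y R \<pi>"
    using that by (simp add: equiconjugacy_def conjugacy_def equisemiconjugacy_def)
  with le ge show ?thesis
    by (auto intro!: antisym)
qed

end
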